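(* Let $(X,\mathcal{T})$ be a noncompact, locally compact Polish space, let $(Y,\mathcal{T}')$ be a Hausdorff space, and let $f:(X,\mathcal{T})\to (Y,\mathcal{T}')$ be a continuous bijection. Let $Y_1\subset Y$ be the set of all discontinuity points of $f^{-1}:Y\to X$ and $X_1=f^{-1}(Y_1)$. Assume that $X_1=\{x_0\}$ for some $x_0\in X$, and that $f$ has a continuous extension $X\cup\{\infty\}\to Y$ to the Alexandroff (one-point) compactification $X\cup\{\infty\}$ of $X$. Then there exists a metric $\delta$ on $X$ such that $(X,\delta)$ is a compact metric space homeomorphic to $(Y,\mathcal{T}')$.
   Context: A Polish space is a separable topological space whose topology is induced by some complete metric. *)

theory Defs
  imports "HOL-Analysis.Analysis"
begin

definition polish_space :: "'a topology \<Rightarrow> bool" where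
  "polish_space X \<longleftrightarrow> separable_space X \<and> completely_metrizable_space X"

definition discontinuity_points :: "'a topology \<Rightarrow> 'b topology \<Rightarrow> ('a \<Rightarrow> 'b) \<Rightarrow> 'a set" where
  "discontinuity_points X Y f = {x \<in> topspace X. \<not> topcontinuous_at X Y f x}"

end

theory Submission
  imports Defs
begin

text \<open>The continuous extension exhibits \<open>Y\<close> as a continuous image of the compact space
  \<open>X \<union> {\<infinity>}\<close>, so \<open>Y\<close> is compact Hausdorff and hence normal. The \<open>f\<close>-images of a countable base
  of \<open>X\<close> form a countable network in \<open>Y\<close>: they need not be open, but every neighbourhood of a
  point contains one of them around that point. Choosing one Urysohn function for every pair of
  network sets that admits one gives countably many continuous functions separating points, which
  embed \<open>Y\<close> in a countable power of the real line. So \<open>Y\<close> is metrizable, and \<open>\<delta>\<close> is the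
  pullback of its metric along \<open>f\<close>.\<close>

lemma separable_metrizable_imp_second_countable:
  assumes "separable_space X" "metrizable_space X"
  shows "second_countable X"
proof -
  obtain M d where "Metric_space M d" and X: "X = Metric_space.mtopology M d"
    using assms(2) by (auto simp: metrizable_space_def)
  then interpret Metric_space M d by simp
  obtain C where C: "countable C" "C \<subseteq> M" "mtopology closure_of C = M"
    using assms(1) by (auto simp: separable_space_def X)
  define \<B> where "\<B> = (\<lambda>(c, n). mball c (inverse (real (Suc n)))) ` (C \<times> UNIV)"
  have "\<exists>V\<in>\<B>. x \<in> V \<and> V \<subseteq> U" if U: "openin mtopology U" "x \<in> U" for U x
  proof -
    obtain r where r: "r > 0" "mball x r \<subseteq> U"
      using U by (auto simp: openin_mtopology)
    \<comment> \<open>The radius is below \<open>r / 2\<close> because it is spent twice: once from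
      \<open>x\<close> to the centre \<open>c\<close>, once from \<open>c\<close> to a point of its
      ball.\<close>
    obtain n where n: "inverse (real (Suc n)) < r / 2"
      using reals_Archimedean[of "r / 2"] r by auto
    have xM: "x \<in> M"
      using U by (auto simp: openin_mtopology)
    have "x \<in> mtopology closure_of C" using C xM by simp
    then obtain c where c: "c \<in> C" "c \<in> mball x (inverse (real (Suc n)))"
      unfolding metric_closure_of by (auto dest!: spec[of _ "inverse (real (Suc n))"])
    have "mball c (inverse (real (Suc n))) \<subseteq> mball x r"
    proof
      fix z assume z: "z \<in> mball c (inverse (real (Suc n)))"
      with c xM have "d x z \<le> d x c + d c z" by (intro triangle) auto
      with z c n xM show "z \<in> mball x r" by auto
    qed
    moreover have "x \<in> mball c (inverse (real (Suc n)))"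
      using c by (auto simp: commute)
    moreover have "mball c (inverse (real (Suc n))) \<in> \<B>"
      using c unfolding \<B>_def by force
    ultimately show ?thesis using r by blast
  qed
  moreover have "countable \<B>" "\<forall>V\<in>\<B>. openin mtopology V"
    using C by (auto simp: \<B>_def)
  ultimately show ?thesis
    unfolding second_countable_def X by blast
qed

text \<open>On a compact space a continuous injection into a Hausdorff space is an embedding, so
  countably many real functions separating points suffice. Pairs of network sets provide the
  countable index set.\<close>

lemma compact_Hausdorff_countable_network_imp_metrizable:
  assumes "compact_space Y" "Hausdorff_space Y" and "countable \<N>"
    and network: "\<And>U y. openin Y U \<Longrightarrow> y \<in> U \<Longrightarrow> \<exists>N\<in>\<N>. y \<in> N \<and> N \<subseteq> U"
  shows "metrizable_space Y"
proof -
  have normal: "normal_space Y"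
    using assms(1,2) by (simp add: compact_Hausdorff_or_regular_imp_normal_space)
  define separates where "separates \<equiv> \<lambda>(h :: 'a \<Rightarrow> real) (A, B).
    continuous_map Y euclideanreal h \<and> (\<forall>a\<in>A. h a < 1/2) \<and> (\<forall>b\<in>B. h b > 1/2)"
  \<comment> \<open>The default \<open>0\<close> keeps the coordinates of inseparable pairs
    continuous.\<close>
  define H where "H \<equiv> \<lambda>p. if \<exists>h. separates h p then SOME h. separates h p else (\<lambda>_. 0)"
  have H: "separates (H p) p" if "separates h p" for h p
    using that someI[of "\<lambda>h. separates h p"] by (auto simp: H_def)
  have H_cont: "continuous_map Y euclideanreal (H p)" for p
  proof (cases "\<exists>h. separates h p")
    case True
    then show ?thesis using H by (cases p) (auto simp: separates_def)
  qed (simp add: H_def)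
  define F where "F \<equiv> \<lambda>y. \<lambda>p\<in>\<N>\<times>\<N>. H p y"
  have "inj_on F (topspace Y)"
  proof (rule inj_onI, rule ccontr)
    fix x y assume xy: "x \<in> topspace Y" "y \<in> topspace Y" "F x = F y" "x \<noteq> y"
    have "closedin Y {x}" "closedin Y {y}"
      using xy assms(2) by (simp_all add: closedin_Hausdorff_singleton)
    then obtain h where h: "continuous_map Y euclideanreal h" "h x = 0" "h y = 1"
      using Urysohn_lemma_alt[OF normal, of "{x}" "{y}" 0 1] xy by auto
    \<comment> \<open>\<open>h\<close> depends on \<open>x\<close> and \<open>y\<close>; it serves
      only to find a pair \<open>(A, B)\<close> around them that admits a separating function. The
      function \<open>H (A, B)\<close> chosen for that pair may differ from \<open>h\<close>, but it
      still separates \<open>x\<close> from \<open>y\<close>.\<close>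
    have "openin Y {z \<in> topspace Y. h z \<in> {..<1/2}}" "openin Y {z \<in> topspace Y. h z \<in> {1/2<..}}"
      by (rule openin_continuous_map_preimage[OF h(1)], simp)+
    then obtain A B where AB: "A \<in> \<N>" "x \<in> A" "A \<subseteq> {z \<in> topspace Y. h z \<in> {..<1/2}}"
        "B \<in> \<N>" "y \<in> B" "B \<subseteq> {z \<in> topspace Y. h z \<in> {1/2<..}}"
      using network[of "{z \<in> topspace Y. h z \<in> {..<1/2}}" x]
        network[of "{z \<in> topspace Y. h z \<in> {1/2<..}}" y] h xy by auto
    then have "separates h (A, B)"
      using h by (auto simp: separates_def)
    then have "separates (H (A, B)) (A, B)" by (rule H)
    then have "H (A, B) x < 1/2" "H (A, B) y > 1/2"
      using AB by (auto simp: separates_def)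
    moreover have "H (A, B) x = H (A, B) y"
      using fun_cong[OF xy(3), of "(A, B)"] AB by (simp add: F_def)
    ultimately show False by simp
  qed
  moreover have "continuous_map Y (product_topology (\<lambda>_. euclideanreal) (\<N>\<times>\<N>)) F"
    using H_cont by (auto simp: continuous_map_componentwise F_def)
  moreover have "Hausdorff_space (product_topology (\<lambda>_. euclideanreal) (\<N>\<times>\<N>))"
    by (simp add: Hausdorff_space_product_topology)
  ultimately have "embedding_map Y (product_topology (\<lambda>_. euclideanreal) (\<N>\<times>\<N>)) F"
    using assms(1) continuous_imp_embedding_map by blast
  moreover have "metrizable_space (product_topology (\<lambda>_. euclideanreal) (\<N>\<times>\<N>))"
    using assms(3) countable_subset[OF Collect_subset, of "\<N>\<times>\<N>"]
    by (auto simp: metrizable_space_product_topology metrizable_space_euclidean)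
  ultimately show ?thesis
    using embedding_map_imp_homeomorphic_space homeomorphic_metrizable_space
      metrizable_space_subtopology by blast
qed

text \<open>Measuring distances between images turns \<open>f\<close> into an isometry onto
  \<open>Y\<close>; injectivity makes distinct points have positive distance.\<close>

lemma metrizable_pullback_bij:
  assumes "metrizable_space Y" and bij: "bij_betw f S (topspace Y)"
  shows "\<exists>\<delta>. Metric_space S \<delta> \<and> Metric_space.mtopology S \<delta> homeomorphic_space Y"
proof -
  obtain M d where M: "Metric_space M d" and Y: "Y = Metric_space.mtopology M d"
    using assms(1) by (auto simp: metrizable_space_def)
  interpret M: Metric_space M d by (rule M)
  have f: "inj_on f S" "f ` S = M"
    using bij by (auto simp: bij_betw_def Y)
  define \<delta> where "\<delta> \<equiv> \<lambda>x y. d (f x) (f y)"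
  interpret S: Metric_space S \<delta>
  proof
    fix x y z
    show "0 \<le> \<delta> x y" "\<delta> x y = \<delta> y x"
      by (simp_all add: \<delta>_def M.commute)
    show "\<delta> x y = 0 \<longleftrightarrow> x = y" if "x \<in> S" "y \<in> S"
      using that f by (auto simp: \<delta>_def inj_on_eq_iff)
    show "\<delta> x z \<le> \<delta> x y + \<delta> y z" if "x \<in> S" "y \<in> S" "z \<in> S"
      using that f unfolding \<delta>_def by (intro M.triangle) auto
  qed
  interpret SM: Metric_space12 S \<delta> M d ..
  have "homeomorphic_map S.mtopology M.mtopology f"
    using f by (intro SM.isometry_imp_homeomorphic_map) (auto simp: \<delta>_def)
  then show ?thesis
    using S.Metric_space_axioms Y homeomorphic_map_imp_homeomorphic_space by blast
qed

theorem theorem3p2: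
  fixes X :: "'a topology" and Y :: "'b topology"
    and f :: "'a \<Rightarrow> 'b" and Y\<^sub>1 :: "'b set" and X\<^sub>1 :: "'a set" and x\<^sub>0 :: 'a
  assumes "polish_space X" and "locally_compact_space X" and "\<not> compact_space X"
    and "Hausdorff_space Y"
    and "continuous_map X Y f" and "bij_betw f (topspace X) (topspace Y)"
    and "Y\<^sub>1 = discontinuity_points Y X (inv_into (topspace X) f)"
    and "X\<^sub>1 = {x \<in> topspace X. f x \<in> Y\<^sub>1}"
    and "x\<^sub>0 \<in> topspace X" and "X\<^sub>1 = {x\<^sub>0}"
    and "\<exists>g. continuous_map (Alexandroff_compactification X) Y g \<and>
             (\<forall>x \<in> topspace X. g (Some x) = f x)"
  shows "\<exists>\<delta>. Metric_space (topspace X) \<delta> \<and>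
             compact_space (Metric_space.mtopology (topspace X) \<delta>) \<and>
             Metric_space.mtopology (topspace X) \<delta> homeomorphic_space Y"
proof -
  obtain g where g: "continuous_map (Alexandroff_compactification X) Y g"
      "\<And>x. x \<in> topspace X \<Longrightarrow> g (Some x) = f x"
    using assms(11) by blast
  have f_img: "f ` topspace X = topspace Y"
    using assms(6) by (simp add: bij_betw_def)
  have "topspace Y \<subseteq> g ` topspace (Alexandroff_compactification X)"
    \<comment> \<open>The points \<open>Some x\<close> alone cover \<open>Y\<close>, since
      \<open>g\<close> extends the surjection \<open>f\<close>.\<close>
    unfolding f_img[symmetric] using g(2) by (force simp: image_iff)
  then have "g ` topspace (Alexandroff_compactification X) = topspace Y"
    using continuous_map_image_subset_topspace[OF g(1)] by blast
  then have compact: "compact_space Y"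
    using image_compactin[OF _ g(1)] compact_space_Alexandroff_compactification
    by (metis compact_space_def)
  have "second_countable X"
    using assms(1) separable_metrizable_imp_second_countable
      completely_metrizable_imp_metrizable_space by (auto simp: polish_space_def)
  then obtain \<B> where \<B>: "countable \<B>"
      "\<And>U x. openin X U \<Longrightarrow> x \<in> U \<Longrightarrow> \<exists>V\<in>\<B>. x \<in> V \<and> V \<subseteq> U"
    unfolding second_countable_def by metis
  have "\<exists>N\<in>(`) f ` \<B>. y \<in> N \<and> N \<subseteq> U" if U: "openin Y U" "y \<in> U" for U y
  proof -
    have "y \<in> f ` topspace X"
      using U openin_subset f_img by blast
    then obtain x where x: "x \<in> topspace X" "f x = y" by blast
    \<comment> \<open>Continuity of \<open>f\<close> pulls \<open>U\<close> back to an open set; a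
      basic set around \<open>x\<close> inside it is then pushed forward.\<close>
    have "openin X {x \<in> topspace X. f x \<in> U}"
      using assms(5) U(1) by (rule openin_continuous_map_preimage)
    then obtain V where "V \<in> \<B>" "x \<in> V" "V \<subseteq> {x \<in> topspace X. f x \<in> U}"
      using \<B>(2)[of _ x] x U(2) by blast
    then show ?thesis using x by blast
  qed
  then have "metrizable_space Y"
    by (rule compact_Hausdorff_countable_network_imp_metrizable
        [OF compact assms(4) countable_image[OF \<B>(1)]])
  \<comment> \<open>By continuity of \<open>f\<close> this metric topology is coarser than
    \<open>X\<close>, strictly so because it is compact and \<open>X\<close> is not.\<close>
  then obtain \<delta> where "Metric_space (topspace X) \<delta>"
      "Metric_space.mtopology (topspace X) \<delta> homeomorphic_space Y"
    using metrizable_pullback_bij[OF _ assms(6)] by blast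
  then show ?thesis
    using compact homeomorphic_compact_space by metis
qed

end
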